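(* Let $\vec{x}$ be the final solution returned by Algorithm A (described in the context) on inputs $f,k,\epsilon,M$. Then $\|\vec{x}\|_1\le k$ and $f(\vec{x})\ge\left(\frac1e-O(\epsilon)\right)f(\vec{x}^* )$, i.e. there is an absolute constant $C$ such that $f(\vec{x})\ge\left(\frac1e-C\epsilon\right)f(\vec{x}^* )$.
   Context: Let $f:[0,1]^n\to\mathbb{R}_+$ be a non-negative differentiable DR-submodular function (i.e. $\nabla f(\vec{x})\ge\nabla f(\vec{y})$ coordinate-wise whenever $\vec{x}\le\vec{y}$), extended to $\mathbb{R}^n_+$ by $f(\vec{x})=f(\vec{x}\wedge\vec{1})$ where $(\vec{x}\wedge\vec{1})_i=\min\{x_i,1\}$. Let $k>0$, let $\epsilon\in(0,1)$ with $1/\epsilon$ an integer, let $\vec{x}^*$ be an optimal solution of $\max\{f(\vec{x}):\vec{x}\in[0,1]^n,\|\vec{x}\|_1\le k\}$, and let $M$ satisfy $f(\vec{x}^* )\le M\le(1+\epsilon)f(\vec{x}^* )$. Notation: $\vec{0},\vec{1}$ are the all-zeros/all-ones vectors, $\vec{1}_S$ is the indicator vector of $S\subseteq[n]$, $\circ$ is the coordinate-wise product, $\le$ between vectors is coordinate-wise. Algorithm A: set $\vec{x}\gets\vec{0}$, $\vec{z}\gets\vec{0}$. For $j=1,\dots,1/\epsilon$ (phase $j$): set $\vec{x}_{\mathrm{start}}\gets\vec{x}$, $\vec{z}_{\mathrm{start}}\gets\vec{z}$, $v_{\mathrm{start}}\gets\frac1k\big(((1-\epsilon)^j-2\epsilon)M-f(\vec{x})\big)$,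 $v\gets v_{\mathrm{start}}$. While $v>\epsilon v_{\mathrm{start}}$ and $\|\vec{z}\|_1<\epsilon jk$ (one iteration): let $\vec{g}=(\vec{1}-\vec{z})\circ\nabla f(\vec{z})$ and $S=\{i\in[n]: \vec{g}_i\ge v,\ \vec{z}_i\le 1-(1-\epsilon)^j,\ \vec{z}_i-(\vec{z}_{\mathrm{start}})_i<\epsilon(1-(\vec{z}_{\mathrm{start}})_i)\}$. If $S=\emptyset$, set $v\gets(1-\epsilon)v$. Otherwise, for $\eta\in[0,\epsilon^2]$ define $\vec{z}(\eta)=\vec{z}+\eta(\vec{1}-\vec{z})\circ\vec{1}_S$, $\vec{g}(\eta)=(\vec{1}-\vec{z}(\eta))\circ\nabla f(\vec{z}(\eta))$, $S(\eta)=\{i\in S:\vec{g}(\eta)_i\ge v\}$, $T(\eta)=\{i\in S:\vec{g}(\eta)_i>0\}$; let $\eta_1$ be the maximum $\eta\in[0,\epsilon^2]$ with $|S(\eta)|\ge(1-\epsilon)|S|$ (computed exactly), let $\eta_2$ be the maximum $\eta\in[0,\epsilon^2]$ with $\|\vec{z}(\eta)\|_1\le\epsilon jk$, and $\eta\gets\min\{\eta_1,\eta_2\}$; then update $\vec{x}\gets\vec{x}+\eta(\vec{1}-\vec{x})\circ\vec{1}_{T(\eta)}$ and $\vec{z}\gets\vec{z}+\eta(\vec{1}-\vec{z})\circ\vec{1}_S$, and if $f(\vec{z})>f(\vec{x})$ set $\vec{x}\gets\vec{z}$. After all phases return $\vec{x}$. *)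

theory Defs
  imports "HOL-Analysis.Analysis"
begin

text \<open>
  A vector of dimension \<open>n\<close> is a function \<open>nat \<Rightarrow> real\<close> whose coordinates are the indices below \<open>n\<close>
  and which vanishes at all other indices, so that \<open>n\<close> can be quantified inside a formula and the
  pointwise order \<open>\<le>\<close> on functions is the coordinate-wise order. A type-indexed dimension would not
  allow one constant to serve all dimensions.
\<close>

type_synonym vector = "nat \<Rightarrow> real"

definition unit_cube :: "nat \<Rightarrow> vector set" where
  "unit_cube n = {x. (\<forall>i<n. 0 \<le> x i \<and> x i \<le> 1) \<and> (\<forall>i\<ge>n. x i = 0)}"

definition l1_norm :: "nat \<Rightarrow> vector \<Rightarrow> real" where
  "l1_norm n x = (\<Sum>i<n. \<bar>x i\<bar>)"

text \<open>
  Total differentiability at \<open>x\<close> relative to the cube (hence one-sided at boundary points), with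
  gradient \<open>g\<close>. The cube has full dimension, so the coordinates of \<open>g\<close> below \<open>n\<close> are unique.
\<close>

definition has_gradient :: "nat \<Rightarrow> (vector \<Rightarrow> real) \<Rightarrow> vector \<Rightarrow> vector \<Rightarrow> bool" where
  "has_gradient n f g x \<longleftrightarrow>
     (\<forall>e>0. \<exists>d>0. \<forall>y\<in>unit_cube n.
        L2_set (\<lambda>i. y i - x i) {..<n} < d \<longrightarrow>
        \<bar>f y - f x - (\<Sum>i<n. g i * (y i - x i))\<bar> \<le> e * L2_set (\<lambda>i. y i - x i) {..<n})"

definition DR_submodular :: "nat \<Rightarrow> (vector \<Rightarrow> real) \<Rightarrow> (vector \<Rightarrow> vector) \<Rightarrow> bool" where
  "DR_submodular n f grad \<longleftrightarrow>
     (\<forall>x\<in>unit_cube n. has_gradient n f (grad x) x) \<and>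
     (\<forall>x\<in>unit_cube n. \<forall>y\<in>unit_cube n. x \<le> y \<longrightarrow> (\<forall>i<n. grad y i \<le> grad x i))"

definition feasible :: "nat \<Rightarrow> real \<Rightarrow> vector set" where
  "feasible n k = {x \<in> unit_cube n. l1_norm n x \<le> k}"

definition optimal_solution :: "nat \<Rightarrow> (vector \<Rightarrow> real) \<Rightarrow> real \<Rightarrow> vector \<Rightarrow> bool" where
  "optimal_solution n f k x \<longleftrightarrow> x \<in> feasible n k \<and> (\<forall>y\<in>feasible n k. f y \<le> f x)"

definition is_maximum :: "real \<Rightarrow> real set \<Rightarrow> bool" where
  "is_maximum m A \<longleftrightarrow> m \<in> A \<and> (\<forall>a\<in>A. a \<le> m)"

text \<open>\<open>move \<eta> T x\<close> is \<open>x + \<eta> (1 - x) \<circ> 1\<^sub>T\<close>.\<close>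

definition move :: "real \<Rightarrow> nat set \<Rightarrow> vector \<Rightarrow> vector" where
  "move \<eta> T x = (\<lambda>i. x i + \<eta> * (1 - x i) * indicator T i)"

text \<open>
  The algorithm is a transition system on states \<open>(x, z, v)\<close>. The locale makes no assumptions;
  it only collects the inputs, \<open>grad\<close> being the gradient of \<open>f\<close>.
\<close>

locale algorithm_A =
  fixes n :: nat
    and f :: "vector \<Rightarrow> real"
    and grad :: "vector \<Rightarrow> vector"
    and k \<epsilon> M :: real
begin

definition scaled_grad :: "vector \<Rightarrow> vector" where
  "scaled_grad z = (\<lambda>i. (1 - z i) * grad z i)"

definition v_start :: "nat \<Rightarrow> vector \<Rightarrow> real" where
  "v_start j x = (((1 - \<epsilon>) ^ j - 2 * \<epsilon>) * M - f x) / k"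

definition cand :: "nat \<Rightarrow> vector \<Rightarrow> vector \<Rightarrow> real \<Rightarrow> nat set" where
  "cand j zs z v =
     {i. i < n \<and> scaled_grad z i \<ge> v \<and> z i \<le> 1 - (1 - \<epsilon>) ^ j \<and> z i - zs i < \<epsilon> * (1 - zs i)}"

inductive iteration :: "nat \<Rightarrow> vector \<Rightarrow> vector \<times> vector \<times> real \<Rightarrow> vector \<times> vector \<times> real \<Rightarrow> bool"
  for j :: nat and zs :: vector where
  lower: "cand j zs z v = {} \<Longrightarrow> iteration j zs (x, z, v) (x, z, (1 - \<epsilon>) * v)"
| advance: "\<lbrakk>S = cand j zs z v; S \<noteq> {};
     is_maximum \<eta>1 {\<eta> \<in> {0..\<epsilon>\<^sup>2}.
       real (card {i \<in> S. scaled_grad (move \<eta> S z) i \<ge> v}) \<ge> (1 - \<epsilon>) * real (card S)};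
     is_maximum \<eta>2 {\<eta> \<in> {0..\<epsilon>\<^sup>2}. l1_norm n (move \<eta> S z) \<le> \<epsilon> * real j * k};
     \<eta> = min \<eta>1 \<eta>2;
     T = {i \<in> S. scaled_grad (move \<eta> S z) i > 0};
     x' = move \<eta> T x;
     z' = move \<eta> S z;
     x'' = (if f z' > f x' then z' else x')\<rbrakk>
   \<Longrightarrow> iteration j zs (x, z, v) (x'', z', v)"

definition guard :: "nat \<Rightarrow> real \<Rightarrow> vector \<times> vector \<times> real \<Rightarrow> bool" where
  "guard j vs = (\<lambda>(x, z, v). v > \<epsilon> * vs \<and> l1_norm n z < \<epsilon> * real j * k)"

text \<open>Phase \<open>j\<close> started in \<open>(xs, zs)\<close> terminates in \<open>(x, z)\<close>.\<close>

definition phase :: "nat \<Rightarrow> vector \<Rightarrow> vector \<Rightarrow> vector \<Rightarrow> vector \<Rightarrow> bool" where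
  "phase j xs zs x z \<longleftrightarrow>
     (\<exists>v. (\<lambda>s s'. guard j (v_start j xs) s \<and> iteration j zs s s')\<^sup>*\<^sup>*
             (xs, zs, v_start j xs) (x, z, v)
          \<and> \<not> guard j (v_start j xs) (x, z, v))"

inductive after_phase :: "nat \<Rightarrow> vector \<Rightarrow> vector \<Rightarrow> bool" where
  init: "after_phase 0 (\<lambda>_. 0) (\<lambda>_. 0)"
| step: "after_phase j xs zs \<Longrightarrow> phase (Suc j) xs zs x z \<Longrightarrow> after_phase (Suc j) x z"

text \<open>Intended for integral \<open>1/\<epsilon>\<close>, where the number of phases is exactly \<open>1/\<epsilon>\<close>.\<close>

definition returns :: "vector \<Rightarrow> bool" where
  "returns x \<longleftrightarrow> (\<exists>z. after_phase (nat \<lfloor>1 / \<epsilon>\<rfloor>) x z)"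

end

end

theory Submission imports Defs begin

text \<open>
  Fix a phase with target \<open>H = ((1 - \<epsilon>)\<^sup>j - 2\<epsilon>) M\<close>, and let \<open>\<sigma>\<^sub>i = (z\<^sub>i - zs\<^sub>i) / (1 - zs\<^sub>i)\<close> be the
  fraction by which coordinate \<open>i\<close> has advanced since the phase began. Because \<open>x \<le> z\<close> and gradients
  are antitone, an iteration that moves \<open>S\<close> by \<open>\<eta>\<close> gains at least
  \<open>(1 - \<epsilon>) \<eta> \<Sum>i\<in>S. max v g\<^sub>i\<close>, so the gain of the phase dominates
  \<open>(1 - \<epsilon>) \<Sum>i. \<sigma>\<^sub>i max v g\<^sub>i\<close>, where \<open>g\<close> is taken at the current \<open>z\<close>.
  If no candidate is left at threshold \<open>v\<close>, every \<open>i\<close> with \<open>g\<^sub>i > v\<close> is saturated, which means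
  \<open>\<sigma>\<^sub>i \<ge> \<epsilon> (1 - \<epsilon>)\<close>. Then the gain so far is at least \<open>(1 - \<epsilon>)\<close> times
  \<open>\<epsilon> (1 - \<epsilon>) \<Sum>i. xopt\<^sub>i (g\<^sub>i - v) + v \<Sum>i. \<sigma>\<^sub>i\<close>, while DR-submodularity gives
  \<open>\<Sum>i. xopt\<^sub>i g\<^sub>i \<ge> H - f x\<close>. A phase ends with \<open>\<Sum>i. \<sigma>\<^sub>i \<ge> \<epsilon> k\<close> or with \<open>v\<close> negligible, and in both
  cases it gains \<open>(1 - O(\<epsilon>)) \<epsilon> (H - f xs)\<close>. Summing this recurrence over the phases yields
  \<open>((1 - \<epsilon>) ^ (1 / \<epsilon>) - O(\<epsilon>)) M\<close>.
\<close>

section \<open>DR-submodular functions on the cube\<close>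

lemma unit_cubeD:
  assumes "x \<in> unit_cube n"
  shows "0 \<le> x i" "x i \<le> 1" "i \<ge> n \<Longrightarrow> x i = 0"
  using assms by (cases "i < n"; force simp: unit_cube_def)+

lemma unit_cube_segment:
  assumes "a \<in> unit_cube n" "b \<in> unit_cube n" "0 \<le> t" "t \<le> 1"
  shows "(\<lambda>i. a i + t * (b i - a i)) \<in> unit_cube n"
proof -
  have "a i + t * (b i - a i) = (1 - t) * a i + t * b i" for i
    by (simp add: algebra_simps)
  moreover have "0 \<le> (1 - t) * a i + t * b i" for i
    using assms unit_cubeD(1) by simp
  moreover have "(1 - t) * a i + t * b i \<le> 1" for i
    using assms unit_cubeD(2) by (intro convex_bound_le) auto
  ultimately show ?thesis
    using unit_cubeD(3)[OF assms(1)] unit_cubeD(3)[OF assms(2)] by (simp add: unit_cube_def)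
qed

lemma l1_norm_unit_cube:
  assumes "x \<in> unit_cube n"
  shows "l1_norm n x = (\<Sum>i<n. x i)"
  unfolding l1_norm_def using unit_cubeD(1)[OF assms] by simp

lemma l1_norm_mono:
  assumes "x \<in> unit_cube n" "x \<le> y"
  shows "l1_norm n x \<le> l1_norm n y"
  unfolding l1_norm_def
proof (rule sum_mono)
  show "\<bar>x i\<bar> \<le> \<bar>y i\<bar>" for i
    using unit_cubeD(1)[OF assms(1), of i] le_funD[OF assms(2), of i] by linarith
qed

text \<open>This is the chain rule along a segment. The segment stays in the cube, so
  differentiability relative to the cube gives a derivative within \<open>{0..1}\<close>, endpoints
  included.\<close>

lemma has_gradient_segment:
  assumes grad: "has_gradient n f g (\<lambda>i. a i + t * (b i - a i))"
    and a: "a \<in> unit_cube n" and b: "b \<in> unit_cube n"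
  shows "((\<lambda>s. f (\<lambda>i. a i + s * (b i - a i))) has_derivative
           (\<lambda>h. (\<Sum>i<n. g i * (b i - a i)) * h)) (at t within {0..1})"
  unfolding has_derivative_within_alt
proof (intro conjI allI impI)
  show "bounded_linear (\<lambda>h. (\<Sum>i<n. g i * (b i - a i)) * h)"
    by (rule bounded_linear_mult_right)
next
  fix e :: real assume "e > 0"
  define L where "L = L2_set (\<lambda>i. b i - a i) {..<n}"
  have L: "L \<ge> 0" by (simp add: L_def)
  let ?p = "\<lambda>s i. a i + s * (b i - a i)"
  have dist: "L2_set (\<lambda>i. ?p s i - ?p t i) {..<n} = \<bar>s - t\<bar> * L" for s
  proof -
    have "(\<lambda>i. ?p s i - ?p t i) = (\<lambda>i. (s - t) * (b i - a i))"
      by (auto simp: algebra_simps)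
    then have "L2_set (\<lambda>i. ?p s i - ?p t i) {..<n} = sqrt ((s - t)\<^sup>2 * (\<Sum>i<n. (b i - a i)\<^sup>2))"
      by (simp add: L2_set_def power_mult_distrib sum_distrib_left)
    also have "\<dots> = \<bar>s - t\<bar> * L"
      by (simp add: L_def L2_set_def real_sqrt_mult)
    finally show ?thesis .
  qed
  \<comment> \<open>The divisor is \<open>L + 1\<close> because \<open>L\<close> vanishes when the
    segment is degenerate.\<close>
  have "e / (L + 1) > 0" using \<open>e > 0\<close> L by simp
  then obtain d where d: "d > 0" and lin:
    "\<And>y. \<lbrakk>y \<in> unit_cube n; L2_set (\<lambda>i. y i - ?p t i) {..<n} < d\<rbrakk> \<Longrightarrow>
        \<bar>f y - f (?p t) - (\<Sum>i<n. g i * (y i - ?p t i))\<bar>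
          \<le> e / (L + 1) * L2_set (\<lambda>i. y i - ?p t i) {..<n}"
    using grad[unfolded has_gradient_def, rule_format, of "e / (L + 1)"] by blast
  show "\<exists>d>0. \<forall>s\<in>{0..1}. norm (s - t) < d \<longrightarrow>
      norm (f (?p s) - f (?p t) - (\<Sum>i<n. g i * (b i - a i)) * (s - t)) \<le> e * norm (s - t)"
  proof (intro exI[of _ "d / (L + 1)"] conjI ballI impI)
    show "d / (L + 1) > 0" using d L by simp
  next
    fix s :: real assume s: "s \<in> {0..1}" "norm (s - t) < d / (L + 1)"
    have "\<bar>s - t\<bar> * L \<le> \<bar>s - t\<bar> * (L + 1)" by (simp add: mult_left_mono)
    also have "\<dots> < d" using s(2) L by (simp add: field_simps)
    finally have "\<bar>f (?p s) - f (?p t) - (\<Sum>i<n. g i * (?p s i - ?p t i))\<bar> \<le> e / (L + 1) * (\<bar>s - t\<bar> * L)"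
      using lin[OF unit_cube_segment[OF a b], of s] s(1) unfolding dist by simp
    also have "(\<Sum>i<n. g i * (?p s i - ?p t i)) = (\<Sum>i<n. g i * (b i - a i)) * (s - t)"
      unfolding sum_distrib_right by (intro sum.cong) (auto simp: algebra_simps)
    also have "e / (L + 1) * (\<bar>s - t\<bar> * L) = e * \<bar>s - t\<bar> * (L / (L + 1))" by simp
    also have "\<dots> \<le> e * \<bar>s - t\<bar> * 1"
      using L \<open>e > 0\<close> by (intro mult_left_mono) auto
    finally show "norm (f (?p s) - f (?p t) - (\<Sum>i<n. g i * (b i - a i)) * (s - t)) \<le> e * norm (s - t)"
      by simp
  qed
qed

text \<open>The mean value theorem turns \<open>f b - f a\<close> into a directional derivative at a
  point between \<open>a\<close> and \<open>b\<close>. Since \<open>a \<le> b\<close>, antitone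
  gradients squeeze it between the values at the two ends. This is the only form in which concavity
  along nonnegative directions is used.\<close>

lemma DR_submodular_segment_bounds:
  assumes DR: "DR_submodular n f grad"
    and a: "a \<in> unit_cube n" and b: "b \<in> unit_cube n" and ab: "a \<le> b"
  shows "(\<Sum>i<n. grad b i * (b i - a i)) \<le> f b - f a"
    and "f b - f a \<le> (\<Sum>i<n. grad a i * (b i - a i))"
proof -
  let ?p = "\<lambda>s i. a i + s * (b i - a i)"
  have le: "a i \<le> b i" for i using ab by (rule le_funD)
  have "\<exists>t\<in>{0<..<1}. f (?p 1) - f (?p 0) = (\<Sum>i<n. grad (?p t) i * (b i - a i)) * (1 - 0)"
    using DR unit_cube_segment[OF a b] has_gradient_segment[OF _ a b]
    by (intro mvt_simple) (auto simp: DR_submodular_def)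
  then obtain t where t: "0 < t" "t < 1"
      and mvt: "f b - f a = (\<Sum>i<n. grad (?p t) i * (b i - a i))"
    by auto
  have p: "?p t \<in> unit_cube n" using unit_cube_segment[OF a b] t by simp
  have "a \<le> ?p t"
    using le t by (simp add: le_fun_def)
  then have lower: "grad (?p t) i \<le> grad a i" if "i < n" for i
    using DR a p that unfolding DR_submodular_def by blast
  have "t * (b i - a i) \<le> 1 * (b i - a i)" for i
    using le[of i] t by (intro mult_right_mono) auto
  then have "?p t \<le> b"
    by (simp add: le_fun_def algebra_simps)
  then have upper: "grad b i \<le> grad (?p t) i" if "i < n" for i
    using DR b p that unfolding DR_submodular_def by blast
  show "(\<Sum>i<n. grad b i * (b i - a i)) \<le> f b - f a"
    unfolding mvt using le upper by (intro sum_mono mult_right_mono) auto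
  show "f b - f a \<le> (\<Sum>i<n. grad a i * (b i - a i))"
    unfolding mvt using le lower by (intro sum_mono mult_right_mono) auto
qed

text \<open>
  The point \<open>u + z \<circ> (1 - u)\<close> divides the segment from \<open>u\<close> to \<open>u + (z / m) \<circ> (1 - u)\<close>, which stays in
  the cube, in the ratio \<open>m : 1 - m\<close>, and \<open>f\<close> is concave along this segment.
\<close>

lemma DR_submodular_join_lower_bound:
  assumes DR: "DR_submodular n f grad"
    and nonneg: "\<And>y. y \<in> unit_cube n \<Longrightarrow> 0 \<le> f y"
    and u: "u \<in> unit_cube n" and z: "z \<in> unit_cube n"
    and m: "0 < m" "m \<le> 1" and zm: "\<And>i. i < n \<Longrightarrow> z i \<le> m"
  shows "(1 - m) * f u \<le> f (\<lambda>i. z i + (1 - z i) * u i)"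
proof -
  note uD = unit_cubeD[OF u] and zD = unit_cubeD[OF z]
  define p where "p = (\<lambda>i. z i + (1 - z i) * u i)"
  define q where "q = (\<lambda>i. u i + z i / m * (1 - u i))"
  have p_eq: "p i = u i + z i * (1 - u i)" for i
    by (simp add: p_def algebra_simps)
  have zm1: "z i / m \<le> 1" for i
    using zm[of i] zD[of i] m by (cases "i < n") (auto simp: divide_le_eq)
  have zz: "z i \<le> z i / m" for i
    using mult_left_mono[OF m(2) zD(1), of i] m by (simp add: le_divide_eq)
  have up: "u \<le> p"
    unfolding le_fun_def p_eq using uD(1,2) zD(1) by simp
  have pq: "p \<le> q"
    unfolding le_fun_def p_eq q_def using uD(2) zz by (intro allI add_left_mono mult_right_mono) auto
  have q1: "q i \<le> 1" for i
    unfolding q_def using mult_right_mono[OF zm1, of "1 - u i" i] uD(2)[of i] by simp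
  have p1: "p i \<le> 1" for i
    using le_funD[OF pq, of i] q1[of i] by simp
  have p0: "0 \<le> p i" for i
    using le_funD[OF up, of i] uD(1)[of i] by simp
  have q0: "0 \<le> q i" for i
    using le_funD[OF pq, of i] p0[of i] by simp
  have p: "p \<in> unit_cube n"
    using p0 p1 uD(3) zD(3) by (simp add: unit_cube_def p_def)
  have q: "q \<in> unit_cube n"
    using q0 q1 uD(3) zD(3) by (simp add: unit_cube_def q_def)
  define D where "D = (\<Sum>i<n. grad p i * (z i * (1 - u i)))"
  have D1: "D \<le> f p - f u"
    using DR_submodular_segment_bounds(1)[OF DR u p up] by (simp add: p_eq D_def)
  have "q i - p i = (1 - m) / m * (z i * (1 - u i))" for i
    using m(1) by (simp add: p_eq q_def field_simps)
  then have "(\<Sum>i<n. grad p i * (q i - p i)) = (1 - m) / m * D"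
    by (simp add: D_def sum_distrib_left mult_ac)
  then have "f q - f p \<le> (1 - m) / m * D"
    using DR_submodular_segment_bounds(2)[OF DR p q pq] by simp
  also have "\<dots> \<le> (1 - m) / m * (f p - f u)"
    using m D1 by (intro mult_left_mono) auto
  finally have "m * (f q - f p) \<le> (1 - m) * (f p - f u)"
    using m(1) by (simp add: field_simps)
  \<comment> \<open>The previous inequality rearranges to
    \<open>m * f q + (1 - m) * f u \<le> f p\<close>; nonnegativity of \<open>f\<close> removes the
    far endpoint \<open>q\<close>.\<close>
  moreover have "0 \<le> m * f q" using nonneg[OF q] m by simp
  ultimately show ?thesis unfolding p_def[symmetric] by (simp add: algebra_simps)
qed

section \<open>Partial moves towards the all-ones vector\<close>

lemma move_le:
  assumes "x \<in> unit_cube n" "0 \<le> \<eta>" shows "x \<le> move \<eta> S x"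
  unfolding le_fun_def move_def using unit_cubeD(2)[OF assms(1)] assms(2) by simp

lemma move_mono_step:
  assumes "x \<in> unit_cube n" "\<eta> \<le> \<eta>'" shows "move \<eta> S x \<le> move \<eta>' S x"
  unfolding le_fun_def move_def using unit_cubeD(2)[OF assms(1)] assms(2)
  by (auto intro!: mult_right_mono)

lemma move_unit_cube:
  assumes x: "x \<in> unit_cube n" and \<eta>: "0 \<le> \<eta>" "\<eta> \<le> 1" and S: "S \<subseteq> {..<n}"
  shows "move \<eta> S x \<in> unit_cube n"
proof -
  have "0 \<le> move \<eta> S x i" for i
    using le_funD[OF move_le[OF x \<eta>(1)], of i S] unit_cubeD(1)[OF x, of i] by simp
  moreover have "move \<eta> S x i \<le> 1" for i
    using unit_cubeD(2)[OF x, of i] mult_right_mono[OF \<eta>(2), of "1 - x i"]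
    by (simp add: move_def indicator_def)
  moreover have "move \<eta> S x i = 0" if "n \<le> i" for i
    using that S unit_cubeD(3)[OF x that] by (auto simp: move_def indicator_def)
  ultimately show ?thesis by (simp add: unit_cube_def)
qed

text \<open>A moved coordinate becomes \<open>(1 - \<eta>) * x i + \<eta>\<close>, which is monotone
  in \<open>x i\<close> for \<open>\<eta> \<le> 1\<close>, and moving fewer coordinates only makes
  the result smaller. This keeps \<open>x \<le> z\<close> although \<open>x\<close> moves along
  \<open>T\<close> and \<open>z\<close> along \<open>S\<close>.\<close>

lemma move_mono:
  assumes xz: "x \<le> z" and z: "z \<in> unit_cube n" and \<eta>: "0 \<le> \<eta>" "\<eta> \<le> 1" and TS: "T \<subseteq> S"
  shows "move \<eta> T x \<le> move \<eta> S z"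
  unfolding le_fun_def
proof
  fix i
  show "move \<eta> T x i \<le> move \<eta> S z i"
  proof (cases "i \<in> T")
    case True
    then have "i \<in> S" using TS by auto
    moreover have "(1 - \<eta>) * x i \<le> (1 - \<eta>) * z i"
      using le_funD[OF xz, of i] \<eta> by (intro mult_left_mono) auto
    ultimately show ?thesis using True by (simp add: move_def algebra_simps)
  next
    case False
    then have "move \<eta> T x i \<le> z i" using le_funD[OF xz, of i] by (simp add: move_def)
    also have "\<dots> \<le> move \<eta> S z i" using move_le[OF z \<eta>(1)] by (rule le_funD)
    finally show ?thesis .
  qed
qed

section \<open>Progress within a phase\<close>

locale algorithm_A_analysis = algorithm_A n f grad k \<epsilon> M
  for n :: nat and f :: "vector \<Rightarrow> real" and grad :: "vector \<Rightarrow> vector" and k \<epsilon> M :: real +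
  fixes xopt :: vector
  assumes nonneg: "\<And>y. y \<in> unit_cube n \<Longrightarrow> 0 \<le> f y"
    and DR: "DR_submodular n f grad"
    and k: "0 < k"
    and eps: "0 < \<epsilon>" "\<epsilon> < 1"
    and opt: "xopt \<in> unit_cube n" "l1_norm n xopt \<le> k"
    and M: "f xopt \<le> M" "M \<le> (1 + \<epsilon>) * f xopt"
begin

lemma grad_antimono:
  assumes "x \<in> unit_cube n" "y \<in> unit_cube n" "x \<le> y" "i < n"
  shows "grad y i \<le> grad x i"
  using DR assms unfolding DR_submodular_def by blast

text \<open>Both factors of the scaled gradient are antitone, but their product is so only where the
  gradient is positive: shrinking \<open>1 - y i\<close> raises a negative product.\<close>

lemma scaled_grad_le:
  assumes x: "x \<in> unit_cube n" and y: "y \<in> unit_cube n" and xy: "x \<le> y" and i: "i < n"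
    and pos: "0 < scaled_grad y i"
  shows "scaled_grad y i \<le> (1 - x i) * grad x i"
proof -
  have "0 < grad y i"
    using pos unit_cubeD(2)[OF y, of i] unfolding scaled_grad_def
    by (simp add: zero_less_mult_iff)
  then show ?thesis
    unfolding scaled_grad_def
    using grad_antimono[OF x y xy i] le_funD[OF xy, of i] unit_cubeD(2)[OF x, of i]
    by (intro mult_mono) auto
qed

section \<open>Target value and coordinate caps of a phase\<close>

definition target :: "nat \<Rightarrow> real" where
  "target j = ((1 - \<epsilon>) ^ j - 2 * \<epsilon>) * M"

text \<open>A coordinate is moved only while \<open>z i \<le> 1 - (1 - \<epsilon>) ^ j\<close>, and
  one move with \<open>\<eta> \<le> \<epsilon>\<^sup>2\<close> multiplies \<open>1 - z i\<close> by
  at least \<open>1 - \<epsilon>\<^sup>2\<close>. The cap is this limit including the possible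
  overshoot.\<close>

definition cap :: "nat \<Rightarrow> real" where
  "cap j = 1 - (1 - \<epsilon>\<^sup>2) * (1 - \<epsilon>) ^ j"

lemma eps_sq: "\<epsilon>\<^sup>2 < 1"
  using eps by (simp add: power_less_one_iff)

lemma cap_bounds: "0 < cap j" "cap j < 1"
proof -
  have "(1 - \<epsilon>\<^sup>2) * (1 - \<epsilon>) ^ j \<le> 1 - \<epsilon>\<^sup>2"
    using eps eps_sq by (intro mult_left_le power_le_one) auto
  moreover have "0 < \<epsilon>\<^sup>2" using eps by simp
  ultimately show "0 < cap j" unfolding cap_def by linarith
  show "cap j < 1" using eps eps_sq by (simp add: cap_def)
qed

lemma cap_mono: "cap j \<le> cap (Suc j)"
proof -
  have "(1 - \<epsilon>\<^sup>2) * (1 - \<epsilon>) ^ Suc j \<le> (1 - \<epsilon>\<^sup>2) * (1 - \<epsilon>) ^ j"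
    using eps eps_sq by (intro mult_left_mono power_decreasing) auto
  then show ?thesis unfolding cap_def by linarith
qed

text \<open>This is what the summand \<open>-2\<epsilon>\<close> in the starting threshold is for.\<close>

lemma target_le: "target j \<le> (1 - cap j) * f xopt"
proof -
  define a where "a = (1 - \<epsilon>) ^ j"
  have a: "0 \<le> a" "a \<le> 1" using eps by (auto simp: a_def power_le_one)
  have fopt: "0 \<le> f xopt" using nonneg opt by simp
  have "(a - 2 * \<epsilon>) * M \<le> ((1 - \<epsilon>\<^sup>2) * a) * f xopt"
  \<comment> \<open>The upper bound on \<open>M\<close> applies only when its coefficient is
    nonnegative; otherwise the target is at most 0.\<close>
  proof (cases "a \<le> 2 * \<epsilon>")
    case True
    have "(a - 2 * \<epsilon>) * M \<le> 0" using True M fopt by (simp add: mult_nonpos_nonneg)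
    also have "\<dots> \<le> ((1 - \<epsilon>\<^sup>2) * a) * f xopt" using a eps_sq fopt by simp
    finally show ?thesis .
  next
    case False
    then have "(a - 2 * \<epsilon>) * M \<le> (a - 2 * \<epsilon>) * ((1 + \<epsilon>) * f xopt)"
      using M by (intro mult_left_mono) auto
    also have "\<dots> = ((a - 2 * \<epsilon>) * (1 + \<epsilon>)) * f xopt" by simp
    also have "\<dots> \<le> ((1 - \<epsilon>\<^sup>2) * a) * f xopt"
    proof (rule mult_right_mono[OF _ fopt])
      have "(\<epsilon> + \<epsilon>\<^sup>2) * a \<le> (\<epsilon> + \<epsilon>\<^sup>2) * 2" using a eps by (intro mult_left_mono) auto
      then show "(a - 2 * \<epsilon>) * (1 + \<epsilon>) \<le> (1 - \<epsilon>\<^sup>2) * a"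
        by (simp add: algebra_simps power2_eq_square)
    qed
    finally show ?thesis .
  qed
  then show ?thesis by (simp add: target_def cap_def a_def)
qed

lemma v_start_eq: "k * v_start j x = target j - f x"
  using k by (simp add: v_start_def target_def)

text \<open>The conjunct \<open>x \<le> z\<close> makes gradients at \<open>z\<close> lower bounds
  for those at \<open>x\<close> and passes the norm bound on to \<open>x\<close>. The conjunct
  \<open>f z \<le> f x\<close>, restored by the final replacement in each advancing iteration,
  allows a deficit measured at \<open>z\<close> to be measured at \<open>x\<close>.\<close>

definition invariant :: "nat \<Rightarrow> vector \<Rightarrow> vector \<Rightarrow> bool" where
  "invariant j x z \<longleftrightarrow> x \<in> unit_cube n \<and> z \<in> unit_cube n \<and> x \<le> z \<and> f z \<le> f x \<and>
     (\<forall>i<n. z i \<le> cap j) \<and> l1_norm n z \<le> \<epsilon> * real j * k"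

definition fraction :: "vector \<Rightarrow> vector \<Rightarrow> nat \<Rightarrow> real" where
  "fraction zs z i = (z i - zs i) / (1 - zs i)"

text \<open>
  The second inequality is the bound obtained when the threshold was last lowered, from \<open>v / (1 - \<epsilon>)\<close>
  to \<open>v\<close>; it refers only to the current state because further increases of \<open>f x\<close> weaken it.
\<close>

definition progress :: "nat \<Rightarrow> vector \<Rightarrow> vector \<Rightarrow> vector \<times> vector \<times> real \<Rightarrow> bool" where
  "progress j xs zs = (\<lambda>(x, z, v). zs \<le> z \<and> 0 < v \<and>
     (1 - \<epsilon>) * (\<Sum>i<n. fraction zs z i * max v (scaled_grad z i)) \<le> f x - f xs \<and>
     \<epsilon> * (1 - \<epsilon>) * ((1 - \<epsilon>) * (target j - f x) - k * v) + (1 - \<epsilon>) * v * (\<Sum>i<n. fraction zs z i)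
       \<le> f x - f xs)"

text \<open>The point \<open>p\<close> lies above \<open>z\<close>, with
  \<open>p i - z i = (1 - z i) * xopt i\<close>, so the right-hand side is the first-order upper
  bound on \<open>f p - f z\<close>. The cap on \<open>z\<close> guarantees that \<open>f p\<close>
  reaches the target.\<close>

lemma sum_scaled_grad_opt:
  assumes z: "z \<in> unit_cube n" and zc: "\<And>i. i < n \<Longrightarrow> z i \<le> cap j"
  shows "target j - f z \<le> (\<Sum>i<n. xopt i * scaled_grad z i)"
proof -
  define p where "p = (\<lambda>i. z i + (1 - z i) * xopt i)"
  have zp: "z \<le> p"
    unfolding le_fun_def p_def using unit_cubeD[OF z] unit_cubeD[OF opt(1)] by simp
  have p1: "p i \<le> 1" for i
  proof -
    have "(1 - z i) * xopt i \<le> (1 - z i) * 1"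
      using unit_cubeD[OF z] unit_cubeD[OF opt(1)] by (intro mult_left_mono) auto
    then show ?thesis by (simp add: p_def)
  qed
  have p0: "0 \<le> p i" for i
    using le_funD[OF zp, of i] unit_cubeD(1)[OF z, of i] by simp
  have p: "p \<in> unit_cube n"
    using p0 p1 unit_cubeD(3)[OF z] unit_cubeD(3)[OF opt(1)] by (simp add: unit_cube_def p_def)
  have "(1 - cap j) * f xopt \<le> f p"
    unfolding p_def using cap_bounds[of j]
    by (intro DR_submodular_join_lower_bound[OF DR nonneg opt(1) z _ _ zc]) auto
  moreover have "f p - f z \<le> (\<Sum>i<n. grad z i * (p i - z i))"
    by (rule DR_submodular_segment_bounds(2)[OF DR z p zp])
  moreover have "(\<Sum>i<n. grad z i * (p i - z i)) = (\<Sum>i<n. xopt i * scaled_grad z i)"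
    by (simp add: p_def scaled_grad_def mult_ac)
  ultimately show ?thesis using target_le[of j] by linarith
qed

section \<open>Fractions advanced in a phase, and their link to the gain\<close>

lemma fraction_bounds:
  assumes zc: "\<And>i. i < n \<Longrightarrow> zs i \<le> cap j" and le: "zs \<le> z" and i: "i < n"
  shows "zs i < 1" "0 \<le> fraction zs z i"
proof -
  show "zs i < 1" using zc[OF i] cap_bounds(2)[of j] by linarith
  then show "0 \<le> fraction zs z i"
    using le_funD[OF le, of i] by (simp add: fraction_def)
qed

text \<open>Either the coordinate advanced by the full fraction \<open>\<epsilon>\<close>, or it
  passed the limit of phase \<open>Suc j\<close>. In the second case \<open>zs i\<close> may already
  exceed the limit of phase \<open>j\<close> by the overshoot in \<open>cap j\<close>, and this
  costs the factor \<open>1 - \<epsilon>\<close>.\<close>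

lemma fraction_saturated:
  assumes zc: "\<And>i. i < n \<Longrightarrow> zs i \<le> cap j" and i: "i < n"
    and sat: "\<not> (z i \<le> 1 - (1 - \<epsilon>) ^ Suc j \<and> z i - zs i < \<epsilon> * (1 - zs i))"
  shows "\<epsilon> * (1 - \<epsilon>) \<le> fraction zs z i"
proof -
  have pos: "0 < 1 - zs i" using zc[OF i] cap_bounds(2)[of j] by linarith
  have "\<epsilon> * (1 - \<epsilon>) * (1 - zs i) \<le> z i - zs i"
  proof (cases "z i \<le> 1 - (1 - \<epsilon>) ^ Suc j")
    case True
    then have "\<epsilon> * (1 - zs i) \<le> z i - zs i" using sat by simp
    moreover have "\<epsilon> * (1 - zs i) * (1 - \<epsilon>) \<le> \<epsilon> * (1 - zs i)"
      using pos eps by (intro mult_left_le) auto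
    ultimately show ?thesis by (simp add: mult_ac)
  next
    case False
    define a where "a = (1 - \<epsilon>) ^ j"
    have zi: "1 - z i \<le> (1 - \<epsilon>) * a" using False by (simp add: a_def)
    have zsi: "(1 - \<epsilon>\<^sup>2) * a \<le> 1 - zs i" using zc[OF i] by (simp add: cap_def a_def)
    have e2: "\<epsilon> * (1 - \<epsilon>) \<le> 1"
      using eps by (intro mult_le_one) auto
    \<comment> \<open>The product equals \<open>1 + \<epsilon> ^ 3\<close>. The factor
      \<open>1 + \<epsilon>\<close> is the quotient of \<open>1 - \<epsilon>\<^sup>2\<close>, from
      the cap, by \<open>1 - \<epsilon>\<close>, from passing to the next limit.\<close>
    have "1 \<le> (1 - \<epsilon> * (1 - \<epsilon>)) * (1 + \<epsilon>)"
      using eps by (simp add: algebra_simps)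
    then have "1 * ((1 - \<epsilon>) * a) \<le> ((1 - \<epsilon> * (1 - \<epsilon>)) * (1 + \<epsilon>)) * ((1 - \<epsilon>) * a)"
      using eps by (intro mult_right_mono) (auto simp: a_def)
    also have "\<dots> = (1 - \<epsilon> * (1 - \<epsilon>)) * ((1 - \<epsilon>\<^sup>2) * a)"
      by (simp add: algebra_simps power2_eq_square)
    also have "\<dots> \<le> (1 - \<epsilon> * (1 - \<epsilon>)) * (1 - zs i)"
      using zsi e2 by (intro mult_left_mono) auto
    finally have "1 - z i \<le> (1 - \<epsilon> * (1 - \<epsilon>)) * (1 - zs i)" using zi by simp
    then show ?thesis by (simp add: left_diff_distrib)
  qed
  then show ?thesis using pos by (simp add: fraction_def le_divide_eq)
qed

text \<open>The first inequality of \<open>progress\<close> only weakens as \<open>v\<close> drops.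
  The second is derived afresh from the first at the old threshold, where the lack of candidates
  forces saturation of all coordinates with gradient above \<open>v\<close>.\<close>

lemma progress_lower:
  assumes inv: "invariant (Suc j) x z" and zc: "\<And>i. i < n \<Longrightarrow> zs i \<le> cap j"
    and prog: "progress (Suc j) xs zs (x, z, v)" and emp: "cand (Suc j) zs z v = {}"
  shows "progress (Suc j) xs zs (x, z, (1 - \<epsilon>) * v)"
proof -
  let ?F = "fraction zs z" and ?g = "scaled_grad z"
  have z: "z \<in> unit_cube n" and zc': "\<And>i. i < n \<Longrightarrow> z i \<le> cap (Suc j)" and fzx: "f z \<le> f x"
    using inv by (auto simp: invariant_def)
  have le: "zs \<le> z" and v: "0 < v"
    and I1: "(1 - \<epsilon>) * (\<Sum>i<n. ?F i * max v (?g i)) \<le> f x - f xs"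
    using prog by (auto simp: progress_def)
  note fb = fraction_bounds[OF zc le]
  have v': "(1 - \<epsilon>) * v \<le> v" using v eps by simp
  have "(\<Sum>i<n. ?F i * max ((1 - \<epsilon>) * v) (?g i)) \<le> (\<Sum>i<n. ?F i * max v (?g i))"
    using fb v' by (intro sum_mono mult_left_mono) auto
  then have "(1 - \<epsilon>) * (\<Sum>i<n. ?F i * max ((1 - \<epsilon>) * v) (?g i))
      \<le> (1 - \<epsilon>) * (\<Sum>i<n. ?F i * max v (?g i))"
    using eps by (intro mult_left_mono) auto
  then have I1': "(1 - \<epsilon>) * (\<Sum>i<n. ?F i * max ((1 - \<epsilon>) * v) (?g i)) \<le> f x - f xs"
    using I1 by linarith
  \<comment> \<open>Below the threshold the \<open>xopt\<close> term is nonpositive; above it,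
    saturation and \<open>xopt i \<le> 1\<close> give
    \<open>xopt i * (\<epsilon> * (1 - \<epsilon>)) \<le> ?F i\<close>.\<close>
  have coord: "\<epsilon> * (1 - \<epsilon>) * (xopt i * ?g i - xopt i * v) + v * ?F i \<le> ?F i * max v (?g i)"
    if i: "i < n" for i
  proof (cases "?g i \<le> v")
    case True
    have "xopt i * ?g i \<le> xopt i * v"
      using True unit_cubeD(1)[OF opt(1)] by (intro mult_left_mono) auto
    then have "\<epsilon> * (1 - \<epsilon>) * (xopt i * ?g i - xopt i * v) \<le> 0"
      using eps by (intro mult_nonneg_nonpos) auto
    then show ?thesis using True by (simp add: max_def mult_ac)
  next
    case False
    have "\<epsilon> * (1 - \<epsilon>) \<le> ?F i"
      using fraction_saturated[of zs j i z, OF zc i] emp False i by (auto simp: cand_def)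
    moreover have "xopt i * (\<epsilon> * (1 - \<epsilon>)) \<le> 1 * (\<epsilon> * (1 - \<epsilon>))"
      using unit_cubeD(2)[OF opt(1)] eps by (intro mult_right_mono) auto
    ultimately have "(xopt i * (\<epsilon> * (1 - \<epsilon>))) * (?g i - v) \<le> ?F i * (?g i - v)"
      using False by (intro mult_right_mono) auto
    then show ?thesis using False by (simp add: max_def algebra_simps)
  qed
  have "k * v \<ge> (\<Sum>i<n. xopt i) * v"
    using opt v by (intro mult_right_mono) (auto simp: l1_norm_unit_cube)
  then have "target (Suc j) - f x - k * v \<le> (\<Sum>i<n. xopt i * ?g i - xopt i * v)"
    using sum_scaled_grad_opt[OF z zc'] fzx by (simp add: sum_subtractf sum_distrib_right)
  then have "\<epsilon> * (1 - \<epsilon>) * (target (Suc j) - f x - k * v)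
      \<le> \<epsilon> * (1 - \<epsilon>) * (\<Sum>i<n. xopt i * ?g i - xopt i * v)"
    using eps by (intro mult_left_mono) auto
  moreover have "\<epsilon> * (1 - \<epsilon>) * (\<Sum>i<n. xopt i * ?g i - xopt i * v) + v * (\<Sum>i<n. ?F i)
      \<le> (\<Sum>i<n. ?F i * max v (?g i))"
    unfolding sum_distrib_left sum.distrib[symmetric] by (intro sum_mono coord) auto
  \<comment> \<open>This factor is given away to reach the form that advancing preserves, since an
    advance guarantees the gain only up to \<open>1 - \<epsilon>\<close>. Multiplying by another
    \<open>1 - \<epsilon>\<close> then turns \<open>v\<close> into the new threshold.\<close>
  moreover have "(1 - \<epsilon>) * v * (\<Sum>i<n. ?F i) \<le> v * (\<Sum>i<n. ?F i)"
    using v' fb by (intro mult_right_mono sum_nonneg) auto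
  ultimately have "\<epsilon> * (1 - \<epsilon>) * (target (Suc j) - f x - k * v) + (1 - \<epsilon>) * v * (\<Sum>i<n. ?F i)
      \<le> (\<Sum>i<n. ?F i * max v (?g i))"
    by linarith
  then have "(1 - \<epsilon>) * (\<epsilon> * (1 - \<epsilon>) * (target (Suc j) - f x - k * v) + (1 - \<epsilon>) * v * (\<Sum>i<n. ?F i))
      \<le> (1 - \<epsilon>) * (\<Sum>i<n. ?F i * max v (?g i))"
    using eps by (intro mult_left_mono) auto
  then have "\<epsilon> * (1 - \<epsilon>) * ((1 - \<epsilon>) * (target (Suc j) - f x) - k * ((1 - \<epsilon>) * v))
       + (1 - \<epsilon>) * ((1 - \<epsilon>) * v) * (\<Sum>i<n. ?F i) \<le> f x - f xs"
    using I1 by (simp add: algebra_simps)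
  then show ?thesis
    using le v eps I1' by (simp add: progress_def)
qed

text \<open>Gradients decrease along the move, so the gain is bounded below by gradients at its end.
  There most of \<open>S\<close> still clears the threshold, and the weighted sum in
  \<open>progress\<close> grows by at most
  \<open>\<eta> * (\<Sum>i\<in>S. max v (?g' i))\<close>.\<close>

lemma advance_step:
  assumes inv: "invariant (Suc j) x z" and zc: "\<And>i. i < n \<Longrightarrow> zs i \<le> cap j"
    and prog: "progress (Suc j) xs zs (x, z, v)"
    and S: "S = cand (Suc j) zs z v"
    and \<eta>1: "\<eta>1 \<in> {0..\<epsilon>\<^sup>2}"
      "(1 - \<epsilon>) * real (card S) \<le> real (card {i \<in> S. scaled_grad (move \<eta>1 S z) i \<ge> v})"
    and \<eta>2: "\<eta>2 \<in> {0..\<epsilon>\<^sup>2}" "l1_norm n (move \<eta>2 S z) \<le> \<epsilon> * real (Suc j) * k"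
    and \<eta>: "\<eta> = min \<eta>1 \<eta>2"
    and T: "T = {i \<in> S. scaled_grad (move \<eta> S z) i > 0}"
    and x': "x' = move \<eta> T x" and z': "z' = move \<eta> S z"
    and x'': "x'' = (if f z' > f x' then z' else x')"
  shows "invariant (Suc j) x'' z'" "progress (Suc j) xs zs (x'', z', v)"
proof -
  let ?F = "fraction zs z" and ?g = "scaled_grad z"
  let ?F' = "fraction zs z'" and ?g' = "scaled_grad z'"
  have x: "x \<in> unit_cube n" and z: "z \<in> unit_cube n" and xz: "x \<le> z" and fzx: "f z \<le> f x"
    and zc': "\<And>i. i < n \<Longrightarrow> z i \<le> cap (Suc j)"
    using inv by (auto simp: invariant_def)
  have le: "zs \<le> z" and v: "0 < v"
    and I1: "(1 - \<epsilon>) * (\<Sum>i<n. ?F i * max v (?g i)) \<le> f x - f xs"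
    and I2: "\<epsilon> * (1 - \<epsilon>) * ((1 - \<epsilon>) * (target (Suc j) - f x) - k * v) + (1 - \<epsilon>) * v * (\<Sum>i<n. ?F i)
       \<le> f x - f xs"
    using prog by (auto simp: progress_def)
  have Sn: "S \<subseteq> {..<n}" by (auto simp: S cand_def)
  then have finS: "finite S" by (rule finite_subset) simp
  have TS: "T \<subseteq> S" by (auto simp: T)
  have \<eta>0: "0 \<le> \<eta>" and \<eta>e: "\<eta> \<le> \<epsilon>\<^sup>2" and \<eta>l1: "\<eta> \<le> \<eta>1" and \<eta>l2: "\<eta> \<le> \<eta>2"
    using \<eta>1(1) \<eta>2(1) by (auto simp: \<eta>)
  have \<eta>11: "\<eta>1 \<le> 1" and \<eta>1': "\<eta> \<le> 1" "0 \<le> \<eta>1" using \<eta>1(1) \<eta>e eps_sq by auto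
  have x'c: "x' \<in> unit_cube n"
    unfolding x' using move_unit_cube[OF x \<eta>0 \<eta>1'(1)] TS Sn by blast
  have z'c: "z' \<in> unit_cube n"
    unfolding z' using move_unit_cube[OF z \<eta>0 \<eta>1'(1) Sn] .
  have xx': "x \<le> x'" unfolding x' by (rule move_le[OF x \<eta>0])
  have zz': "z \<le> z'" unfolding z' by (rule move_le[OF z \<eta>0])
  have x'z': "x' \<le> z'" unfolding x' z' by (rule move_mono[OF xz z \<eta>0 \<eta>1'(1) TS])
  have cap': "z' i \<le> cap (Suc j)" if i: "i < n" for i
  proof (cases "i \<in> S")
    case True
    then have "(1 - \<epsilon>) ^ Suc j \<le> 1 - z i" by (simp add: S cand_def)
    then have "(1 - \<epsilon>\<^sup>2) * (1 - \<epsilon>) ^ Suc j \<le> (1 - \<eta>) * (1 - z i)"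
      using \<eta>e eps eps_sq by (intro mult_mono) auto
    also have "\<dots> = 1 - z' i" using True by (simp add: z' move_def algebra_simps)
    finally show ?thesis by (simp add: cap_def)
  next
    case False
    then show ?thesis using zc'[OF i] by (simp add: z' move_def)
  qed
  have "l1_norm n z' \<le> l1_norm n (move \<eta>2 S z)"
    using l1_norm_mono[OF z'c] move_mono_step[OF z \<eta>l2] unfolding z' by blast
  then have l1: "l1_norm n z' \<le> \<epsilon> * real (Suc j) * k" using \<eta>2(2) by linarith
  show "invariant (Suc j) x'' z'"
    unfolding invariant_def x'' using x'c z'c x'z' cap' l1 by auto

  \<comment> \<open>A scaled gradient that is at least \<open>v > 0\<close> after moving by
    \<open>\<eta>1\<close> was at least as large after the shorter move by
    \<open>\<eta>\<close>.\<close>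
  have "{i \<in> S. ?g' i \<ge> v} \<supseteq> {i \<in> S. scaled_grad (move \<eta>1 S z) i \<ge> v}"
  proof
    fix i assume i: "i \<in> {i \<in> S. scaled_grad (move \<eta>1 S z) i \<ge> v}"
    have "scaled_grad (move \<eta>1 S z) i \<le> ?g' i"
      using scaled_grad_le[OF z'c move_unit_cube[OF z \<eta>1'(2) \<eta>11 Sn], of i] i v Sn
        move_mono_step[OF z \<eta>l1] z'
      by (auto simp: scaled_grad_def)
    then show "i \<in> {i \<in> S. ?g' i \<ge> v}" using i by auto
  qed
  then have "card {i \<in> S. scaled_grad (move \<eta>1 S z) i \<ge> v} \<le> card {i \<in> S. ?g' i \<ge> v}"
    using finS by (intro card_mono) auto
  then have cardS: "(1 - \<epsilon>) * real (card S) \<le> real (card {i \<in> S. ?g' i \<ge> v})"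
    using \<eta>1(2) by linarith

  \<comment> \<open>Counting \<open>B\<close> at \<open>v\<close> costs
    \<open>(1 - \<epsilon>) * v * card B\<close>, at most
    \<open>\<epsilon> * (1 - \<epsilon>) * v * card S\<close>. The set \<open>A\<close> pays for
    this with an \<open>\<epsilon>\<close> share of its sum, having at least
    \<open>(1 - \<epsilon>) * card S\<close> elements of value at least \<open>v\<close>.\<close>
  define A where "A = {i \<in> S. ?g' i \<ge> v}"
  define B where "B = {i \<in> S. ?g' i < v}"
  have AB: "S = A \<union> B" "A \<inter> B = {}" "finite A" "finite B"
    using finS by (auto simp: A_def B_def)
  have cAB: "real (card S) = real (card A) + real (card B)"
    using card_Un_disjoint[OF AB(3,4,2)] AB(1) by simp
  have "real (card A) * v \<le> (\<Sum>i\<in>A. ?g' i)"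
    using sum_bounded_below[of A v ?g'] by (simp add: A_def)
  moreover have "(1 - \<epsilon>) * real (card S) * v \<le> real (card A) * v"
    using cardS v by (intro mult_right_mono) (auto simp: A_def)
  ultimately have gA: "\<epsilon> * ((1 - \<epsilon>) * real (card S) * v) \<le> \<epsilon> * (\<Sum>i\<in>A. ?g' i)"
    using eps by (intro mult_left_mono) auto
  have "real (card B) \<le> \<epsilon> * real (card S)"
    using cardS cAB by (simp add: A_def[symmetric] algebra_simps)
  then have "((1 - \<epsilon>) * v) * real (card B) \<le> ((1 - \<epsilon>) * v) * (\<epsilon> * real (card S))"
    using eps v by (intro mult_left_mono) auto
  moreover have "(\<Sum>i\<in>S. max v (?g' i)) = (\<Sum>i\<in>A. ?g' i) + real (card B) * v"
  proof -
    have "(\<Sum>i\<in>S. max v (?g' i)) = (\<Sum>i\<in>A. max v (?g' i)) + (\<Sum>i\<in>B. max v (?g' i))"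
      using AB sum.union_disjoint by metis
    moreover have "(\<Sum>i\<in>A. max v (?g' i)) = (\<Sum>i\<in>A. ?g' i)"
      by (intro sum.cong) (auto simp: A_def)
    moreover have "(\<Sum>i\<in>B. max v (?g' i)) = (\<Sum>i\<in>B. v)"
      by (intro sum.cong) (auto simp: B_def)
    ultimately show ?thesis by simp
  qed
  ultimately have rate: "(1 - \<epsilon>) * (\<Sum>i\<in>S. max v (?g' i)) \<le> (\<Sum>i\<in>A. ?g' i)"
    using gA by (simp add: algebra_simps)
  have "(\<Sum>i\<in>A. ?g' i) \<le> (\<Sum>i\<in>T. ?g' i)"
    using v finS by (intro sum_mono2) (auto simp: A_def T z')
  also have "\<eta> * \<dots> \<le> (\<Sum>i\<in>T. grad x' i * (\<eta> * (1 - x i)))"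
    unfolding sum_distrib_left
  proof (rule sum_mono)
    fix i assume i: "i \<in> T"
    then have "i < n" "0 < ?g' i" using TS Sn by (auto simp: T z')
    then have g: "?g' i \<le> (1 - x' i) * grad x' i" "0 < ?g' i"
      using scaled_grad_le[OF x'c z'c x'z'] by auto
    then have "0 < grad x' i"
      using unit_cubeD(2)[OF x'c, of i] by (smt (verit) mult_nonneg_nonpos)
    then have "(1 - x' i) * grad x' i \<le> (1 - x i) * grad x' i"
      using le_funD[OF xx', of i] by (intro mult_right_mono) auto
    then have "\<eta> * ?g' i \<le> \<eta> * ((1 - x i) * grad x' i)"
      using g \<eta>0 by (intro mult_left_mono) auto
    then show "\<eta> * ?g' i \<le> grad x' i * (\<eta> * (1 - x i))" by (simp add: mult_ac)
  qed
  also have "\<dots> = (\<Sum>i<n. grad x' i * (x' i - x i))"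
    using TS Sn by (intro sum.mono_neutral_cong_left) (auto simp: x' move_def)
  also have "\<dots> \<le> f x' - f x"
    by (rule DR_submodular_segment_bounds(1)[OF DR x x'c xx'])
  also have "\<dots> \<le> f x'' - f x" by (simp add: x'')
  finally have "\<eta> * (\<Sum>i\<in>A. ?g' i) \<le> f x'' - f x"
    using \<eta>0 by (auto intro: mult_left_mono)
  moreover have "\<eta> * ((1 - \<epsilon>) * (\<Sum>i\<in>S. max v (?g' i))) \<le> \<eta> * (\<Sum>i\<in>A. ?g' i)"
    using rate \<eta>0 by (intro mult_left_mono) auto
  ultimately have gain: "(1 - \<epsilon>) * (\<eta> * (\<Sum>i\<in>S. max v (?g' i))) \<le> f x'' - f x"
    by (simp add: mult_ac)

  \<comment> \<open>A move raises the fraction by \<open>\<eta> * (1 - z i) / (1 - zs i)\<close>,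
    and \<open>zs \<le> z\<close>.\<close>
  have frac: "?F' i \<le> ?F i + \<eta> * indicator S i" if i: "i < n" for i
  proof -
    have pos: "0 < 1 - zs i" using fraction_bounds(1)[OF zc le i] by simp
    have "z' i - zs i \<le> (z i - zs i) + \<eta> * indicator S i * (1 - zs i)"
      using mult_left_mono[OF le_funD[OF le, of i] \<eta>0]
      by (simp add: z' move_def indicator_def algebra_simps)
    then have "?F' i \<le> ((z i - zs i) + \<eta> * indicator S i * (1 - zs i)) / (1 - zs i)"
      unfolding fraction_def using pos by (intro divide_right_mono) auto
    also have "\<dots> = ?F i + \<eta> * indicator S i"
      using pos by (simp add: fraction_def add_divide_distrib)
    finally show ?thesis .
  qed
  \<comment> \<open>The maximum with the positive \<open>v\<close> hides nonpositive scaled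
    gradients, for which monotonicity may fail.\<close>
  have maxle: "max v (?g' i) \<le> max v (?g i)" if i: "i < n" for i
  proof (cases "?g' i > 0")
    case True
    then show ?thesis using scaled_grad_le[OF z z'c zz' i] by (simp add: scaled_grad_def max_def)
  next
    case False
    then show ?thesis using v by simp
  qed
  have indS: "(\<Sum>i<n. indicator S i * h i) = (\<Sum>i\<in>S. h i)" for h :: "nat \<Rightarrow> real"
    using Sn by (intro sum.mono_neutral_cong_right) auto
  have "(\<Sum>i<n. ?F' i * max v (?g' i)) \<le> (\<Sum>i<n. ?F i * max v (?g i) + \<eta> * (indicator S i * max v (?g' i)))"
  proof (rule sum_mono)
    fix i assume "i \<in> {..<n}" then have i: "i < n" by simp
    have "?F' i * max v (?g' i) \<le> (?F i + \<eta> * indicator S i) * max v (?g' i)"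
      using frac[OF i] v by (intro mult_right_mono) auto
    moreover have "?F i * max v (?g' i) \<le> ?F i * max v (?g i)"
      using maxle[OF i] fraction_bounds(2)[OF zc le i] by (intro mult_left_mono) auto
    ultimately show "?F' i * max v (?g' i) \<le> ?F i * max v (?g i) + \<eta> * (indicator S i * max v (?g' i))"
      by (simp add: algebra_simps)
  qed
  also have "\<dots> = (\<Sum>i<n. ?F i * max v (?g i)) + \<eta> * (\<Sum>i\<in>S. max v (?g' i))"
    by (simp add: sum.distrib sum_distrib_left[symmetric] indS)
  finally have "(1 - \<epsilon>) * (\<Sum>i<n. ?F' i * max v (?g' i))
      \<le> (1 - \<epsilon>) * ((\<Sum>i<n. ?F i * max v (?g i)) + \<eta> * (\<Sum>i\<in>S. max v (?g' i)))"
    using eps by (intro mult_left_mono) auto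
  then have I1': "(1 - \<epsilon>) * (\<Sum>i<n. ?F' i * max v (?g' i)) \<le> f x'' - f xs"
    using I1 gain by (simp add: distrib_left)

  have "(\<Sum>i<n. ?F' i) \<le> (\<Sum>i<n. ?F i + \<eta> * indicator S i)"
    using frac by (intro sum_mono) auto
  also have "\<dots> = (\<Sum>i<n. ?F i) + \<eta> * real (card S)"
    using indS[of "\<lambda>_. 1"] by (simp add: sum.distrib sum_distrib_left[symmetric])
  finally have "(1 - \<epsilon>) * v * (\<Sum>i<n. ?F' i) \<le> (1 - \<epsilon>) * v * ((\<Sum>i<n. ?F i) + \<eta> * real (card S))"
    using eps v by (intro mult_left_mono) auto
  moreover have "real (card S) * v \<le> (\<Sum>i\<in>S. max v (?g' i))"
    using sum_bounded_below[of S v "\<lambda>i. max v (?g' i)"] by simp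
  then have "(1 - \<epsilon>) * (\<eta> * (real (card S) * v)) \<le> (1 - \<epsilon>) * (\<eta> * (\<Sum>i\<in>S. max v (?g' i)))"
    using eps \<eta>0 by (intro mult_left_mono) auto
  moreover have "f x \<le> f x''"
  proof -
    have "0 \<le> (\<Sum>i\<in>S. max v (?g' i))" using v by (intro sum_nonneg) auto
    then have "0 \<le> (1 - \<epsilon>) * (\<eta> * (\<Sum>i\<in>S. max v (?g' i)))" using eps \<eta>0 by simp
    then show ?thesis using gain by linarith
  qed
  then have "\<epsilon> * (1 - \<epsilon>) * ((1 - \<epsilon>) * (target (Suc j) - f x'') - k * v)
      \<le> \<epsilon> * (1 - \<epsilon>) * ((1 - \<epsilon>) * (target (Suc j) - f x) - k * v)"
    using eps by (intro mult_left_mono diff_right_mono) auto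
  ultimately have I2': "\<epsilon> * (1 - \<epsilon>) * ((1 - \<epsilon>) * (target (Suc j) - f x'') - k * v)
      + (1 - \<epsilon>) * v * (\<Sum>i<n. ?F' i) \<le> f x'' - f xs"
    using I2 gain unfolding distrib_left[of "(1 - \<epsilon>) * v"] by (simp add: mult_ac)
  show "progress (Suc j) xs zs (x'', z', v)"
    using order_trans[OF le zz'] v I1' I2' by (simp add: progress_def)
qed

section \<open>From single iterations to a whole phase\<close>

lemma iteration_preserves:
  assumes it: "iteration (Suc j) zs (x, z, v) (x', z', v')"
    and inv: "invariant (Suc j) x z" and zc: "\<And>i. i < n \<Longrightarrow> zs i \<le> cap j"
    and prog: "progress (Suc j) xs zs (x, z, v)"
  shows "invariant (Suc j) x' z' \<and> progress (Suc j) xs zs (x', z', v')"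
  using it
proof cases
  case lower
  then show ?thesis using inv progress_lower[OF inv zc prog] by simp
next
  case (advance S \<eta>1 \<eta>2 \<eta> T x1)
  then show ?thesis
    using advance_step[OF inv zc prog advance(2) _ _ _ _ advance(6,7,8,9)]
    by (auto simp: is_maximum_def)
qed

lemma invariant_Suc:
  assumes "invariant j x z" shows "invariant (Suc j) x z"
proof -
  have "\<epsilon> * real j * k \<le> \<epsilon> * real (Suc j) * k" using eps k by simp
  then show ?thesis
    using assms cap_mono[of j] unfolding invariant_def by (meson order_trans)
qed

text \<open>A nonpositive starting threshold is at most \<open>\<epsilon>\<close> times itself, so
  the guard fails at once and the phase changes nothing; hence the case distinction in the last
  conclusion.\<close>

lemma phase_end:
  assumes ph: "phase (Suc j) xs zs x z" and inv: "invariant j xs zs"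
  obtains v where "\<not> guard (Suc j) (v_start (Suc j) xs) (x, z, v)" "invariant (Suc j) x z"
    "if 0 < v_start (Suc j) xs then progress (Suc j) xs zs (x, z, v) else x = xs"
proof -
  let ?vs = "v_start (Suc j) xs"
  obtain v where run: "(\<lambda>s s'. guard (Suc j) ?vs s \<and> iteration (Suc j) zs s s')\<^sup>*\<^sup>*
             (xs, zs, ?vs) (x, z, v)" and stop: "\<not> guard (Suc j) ?vs (x, z, v)"
    using ph unfolding phase_def by blast
  have zc: "\<And>i. i < n \<Longrightarrow> zs i \<le> cap j" using inv by (simp add: invariant_def)
  have inv0: "invariant (Suc j) xs zs" using inv by (rule invariant_Suc)
  show ?thesis
  proof (cases "0 < ?vs")
    case False
    then have ng: "\<not> guard (Suc j) ?vs (xs, zs, ?vs)"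
      using eps mult_right_mono_neg[of \<epsilon> 1 ?vs] by (simp add: guard_def)
    from run have "(x, z, v) = (xs, zs, ?vs)"
      by (cases rule: converse_rtranclpE) (use ng in auto)
    then show ?thesis using that stop inv0 False by simp
  next
    case True
    define D where "D = target (Suc j) - f xs"
    have "D = k * ?vs" by (simp add: D_def v_start_eq)
    then have D: "D = k * ?vs" "0 < D" using True k by simp_all
    \<comment> \<open>Initially all fractions are 0 and \<open>k * v\<close> equals the whole
      deficit \<open>D\<close>, so both inequalities of \<open>progress\<close> have left-hand sides
      at most 0.\<close>
    have "(1 - \<epsilon>) * D - D \<le> 0" using D(2) eps by (simp add: algebra_simps)
    then have "\<epsilon> * (1 - \<epsilon>) * ((1 - \<epsilon>) * D - D) \<le> 0"
      using eps by (intro mult_nonneg_nonpos) auto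
    then have prog0: "progress (Suc j) xs zs (xs, zs, ?vs)"
      using True D by (simp add: progress_def fraction_def D_def)
    have "invariant (Suc j) (fst s) (fst (snd s)) \<and> progress (Suc j) xs zs s"
      if "(\<lambda>s s'. guard (Suc j) ?vs s \<and> iteration (Suc j) zs s s')\<^sup>*\<^sup>* (xs, zs, ?vs) s" for s
      using that
    proof induction
      case base
      then show ?case using inv0 prog0 by simp
    next
      case (step s s')
      then show ?case
        using iteration_preserves[OF _ _ zc] by (cases s; cases s') auto
    qed
    from this[OF run] show ?thesis using that stop True by simp
  qed
qed

lemma phase_progress:
  assumes ph: "phase (Suc j) xs zs x z" and inv: "invariant j xs zs" and e4: "\<epsilon> \<le> 1 / 4"
  shows "\<epsilon> * (1 - 4 * \<epsilon>) * (target (Suc j) - f xs) \<le> f x - f xs"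
proof -
  let ?vs = "v_start (Suc j) xs"
  obtain v where stop: "\<not> guard (Suc j) ?vs (x, z, v)" and invx: "invariant (Suc j) x z"
    and prog: "if 0 < ?vs then progress (Suc j) xs zs (x, z, v) else x = xs"
    using phase_end[OF ph inv] .
  have zc: "\<And>i. i < n \<Longrightarrow> zs i \<le> cap j" using inv by (simp add: invariant_def)
  show ?thesis
  proof (cases "0 < ?vs")
    case False
    then have "target (Suc j) - f xs \<le> 0"
      using v_start_eq[of "Suc j" xs, symmetric] k by (simp add: mult_le_0_iff)
    then have "\<epsilon> * (1 - 4 * \<epsilon>) * (target (Suc j) - f xs) \<le> 0"
      using eps e4 by (intro mult_nonneg_nonpos) auto
    then show ?thesis using prog False by simp
  next
    case True
    define D where "D = target (Suc j) - f xs"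
    have "D = k * ?vs" by (simp add: D_def v_start_eq)
    then have D: "D = k * ?vs" "0 < D" using True k by simp_all
    define G where "G = f x - f xs"
    define \<Phi> where "\<Phi> = (\<Sum>i<n. fraction zs z i)"
    have le: "zs \<le> z" and v: "0 < v"
      and I2: "\<epsilon> * (1 - \<epsilon>) * ((1 - \<epsilon>) * (D - G) - k * v) + (1 - \<epsilon>) * v * \<Phi> \<le> G"
      using prog True by (auto simp: progress_def D_def G_def \<Phi>_def)
    have \<Phi>0: "0 \<le> \<Phi>" unfolding \<Phi>_def using fraction_bounds(2)[OF zc le] by (intro sum_nonneg) auto
    \<comment> \<open>Common consequence of the two ways to stop: either
      \<open>k * v \<le> \<epsilon> * D\<close>, or the norm budget is full and the
      \<open>\<Phi>\<close> term cancels \<open>k * v\<close>.\<close>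
    have key: "\<epsilon> * (1 - \<epsilon>) * ((1 - \<epsilon>) * (D - G) - \<epsilon> * D) \<le> G"
    proof (cases "v \<le> \<epsilon> * ?vs")
      case True
      have "k * v \<le> \<epsilon> * D" using mult_left_mono[OF True, of k] k by (simp add: D mult_ac)
      then have "\<epsilon> * (1 - \<epsilon>) * ((1 - \<epsilon>) * (D - G) - \<epsilon> * D) \<le> \<epsilon> * (1 - \<epsilon>) * ((1 - \<epsilon>) * (D - G) - k * v)"
        using eps by (intro mult_left_mono) auto
      moreover have "0 \<le> (1 - \<epsilon>) * v * \<Phi>" using eps v \<Phi>0 by simp
      ultimately show ?thesis using I2 by linarith
    next
      case False
      then have full: "\<epsilon> * real (Suc j) * k \<le> l1_norm n z"
        using stop by (simp add: guard_def)
      have zsc: "zs \<in> unit_cube n" "l1_norm n zs \<le> \<epsilon> * real j * k" and zc1: "z \<in> unit_cube n"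
        using inv invx by (auto simp: invariant_def)
      \<comment> \<open>The phase started with norm at most \<open>\<epsilon> * real j * k\<close>
        and ended with at least \<open>\<epsilon> * real (Suc j) * k\<close>.\<close>
      have "\<epsilon> * k \<le> (\<Sum>i<n. z i - zs i)"
        using full zsc(2) by (simp add: l1_norm_unit_cube[OF zsc(1)] l1_norm_unit_cube[OF zc1]
            sum_subtractf algebra_simps)
      also have "\<dots> \<le> \<Phi>"
        unfolding \<Phi>_def
      proof (rule sum_mono)
        fix i assume "i \<in> {..<n}" then have i: "i < n" by simp
        have "(z i - zs i) * (1 - zs i) \<le> (z i - zs i) * 1"
          using le_funD[OF le, of i] unit_cubeD(1)[OF zsc(1), of i] by (intro mult_left_mono) auto
        then show "z i - zs i \<le> fraction zs z i"
          using fraction_bounds(1)[OF zc le i] by (simp add: fraction_def le_divide_eq)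
      qed
      finally have "(1 - \<epsilon>) * v * (\<epsilon> * k) \<le> (1 - \<epsilon>) * v * \<Phi>"
        using eps v by (intro mult_left_mono) auto
      then have "\<epsilon> * (1 - \<epsilon>) * ((1 - \<epsilon>) * (D - G)) \<le> G"
        using I2 by (simp add: algebra_simps)
      moreover have "\<epsilon> * (1 - \<epsilon>) * ((1 - \<epsilon>) * (D - G) - \<epsilon> * D) \<le> \<epsilon> * (1 - \<epsilon>) * ((1 - \<epsilon>) * (D - G))"
        using eps D by (intro mult_left_mono) auto
      ultimately show ?thesis by linarith
    qed
    have "\<epsilon> * (1 - \<epsilon>) * (1 - 2 * \<epsilon>) * D \<le> (1 + \<epsilon> * (1 - \<epsilon>)\<^sup>2) * G"
      using key by (simp add: algebra_simps power2_eq_square)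
    moreover have "0 \<le> \<epsilon> * (1 - \<epsilon>) * (1 - 2 * \<epsilon>) * D" using eps e4 D by simp
    ultimately have "0 \<le> (1 + \<epsilon> * (1 - \<epsilon>)\<^sup>2) * G" by linarith
    moreover have pos: "0 < 1 + \<epsilon> * (1 - \<epsilon>)\<^sup>2"
      using eps by (simp add: add_pos_nonneg)
    ultimately have G0: "0 \<le> G" by (simp add: zero_le_mult_iff)
    have "(1 + \<epsilon> * (1 - \<epsilon>)\<^sup>2) * G \<le> (1 + \<epsilon>) * G"
    proof (rule mult_right_mono[OF _ G0])
      have "\<epsilon> * (1 - \<epsilon>)\<^sup>2 \<le> \<epsilon> * 1" using eps by (intro mult_left_mono power_le_one) auto
      then show "1 + \<epsilon> * (1 - \<epsilon>)\<^sup>2 \<le> 1 + \<epsilon>" by simp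
    qed
    moreover have "(1 + \<epsilon>) * (\<epsilon> * (1 - 4 * \<epsilon>) * D) \<le> \<epsilon> * (1 - \<epsilon>) * (1 - 2 * \<epsilon>) * D"
    proof -
      \<comment> \<open>The left side is \<open>1 - 3 * \<epsilon> - 4 * \<epsilon>\<^sup>2\<close>,
        the right side \<open>1 - 3 * \<epsilon> + 2 * \<epsilon>\<^sup>2\<close>; the constant 4
        makes the linear terms agree.\<close>
      have "(1 + \<epsilon>) * (1 - 4 * \<epsilon>) \<le> (1 - \<epsilon>) * (1 - 2 * \<epsilon>)"
        by (simp add: algebra_simps)
      then have "((1 + \<epsilon>) * (1 - 4 * \<epsilon>)) * (\<epsilon> * D) \<le> ((1 - \<epsilon>) * (1 - 2 * \<epsilon>)) * (\<epsilon> * D)"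
        using eps D by (intro mult_right_mono) auto
      then show ?thesis by (simp add: mult_ac)
    qed
    ultimately have "(1 + \<epsilon>) * (\<epsilon> * (1 - 4 * \<epsilon>) * D) \<le> (1 + \<epsilon>) * G"
      using \<open>\<epsilon> * (1 - \<epsilon>) * (1 - 2 * \<epsilon>) * D \<le> (1 + \<epsilon> * (1 - \<epsilon>)\<^sup>2) * G\<close> by linarith
    then have "\<epsilon> * (1 - 4 * \<epsilon>) * D \<le> G"
      using eps by (simp add: mult_le_cancel_left_pos)
    then show ?thesis by (simp add: D_def G_def)
  qed
qed

section \<open>The recurrence over the phases\<close>

lemma after_phase_invariant:
  "after_phase j x z \<Longrightarrow> invariant j x z"
proof (induction rule: after_phase.induct)
  case init
  have "0 \<le> cap 0" using cap_bounds(1)[of 0] by simp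
  then show ?case by (simp add: invariant_def unit_cube_def l1_norm_def)
next
  case (step j xs zs x z)
  then show ?case using phase_end by blast
qed

text \<open>Without error terms the recurrence is \<open>a (Suc j) = (1 - \<epsilon>) * a j +
  \<epsilon> * (1 - \<epsilon>) ^ Suc j\<close>, solved by
  \<open>a j = real j * \<epsilon> * (1 - \<epsilon>) ^ j\<close>. Each phase adds an error of at
  most \<open>6 * \<epsilon>\<^sup>2\<close>.\<close>

lemma after_phase_value:
  assumes "after_phase j x z" and e4: "\<epsilon> \<le> 1 / 4"
  shows "(real j * \<epsilon> * (1 - \<epsilon>) ^ j - 6 * \<epsilon>\<^sup>2 * real j) * M \<le> f x"
  using assms(1)
proof (induction rule: after_phase.induct)
  case init
  show ?case using nonneg[of "\<lambda>_. 0"] by (simp add: unit_cube_def)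
next
  case (step j xs zs x z)
  define p where "p = (1 - \<epsilon>) ^ Suc j"
  define \<beta> where "\<beta> = \<epsilon> * (1 - 4 * \<epsilon>)"
  have invs: "invariant j xs zs" by (rule after_phase_invariant[OF step.hyps(1)])
  have M0: "0 \<le> M" using nonneg[OF opt(1)] M by linarith
  have fxs: "0 \<le> f xs" using nonneg invs by (simp add: invariant_def)
  have p: "0 \<le> p" "p \<le> 1" using eps by (auto simp: p_def intro!: power_le_one mult_le_one)
  have "\<beta> * ((p - 2 * \<epsilon>) * M - f xs) \<le> f x - f xs"
    using phase_progress[OF step.hyps(2) invs e4] by (simp add: \<beta>_def target_def p_def)
  then have "(1 - \<beta>) * f xs + \<beta> * (p - 2 * \<epsilon>) * M \<le> f x"
    by (simp add: algebra_simps)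
  moreover have "(1 - \<epsilon>) * f xs \<le> (1 - \<beta>) * f xs"
    using fxs eps by (intro mult_right_mono) (auto simp: \<beta>_def algebra_simps)
  moreover have "(1 - \<epsilon>) * ((real j * \<epsilon> * (1 - \<epsilon>) ^ j - 6 * \<epsilon>\<^sup>2 * real j) * M) \<le> (1 - \<epsilon>) * f xs"
    using step.IH eps by (intro mult_left_mono) auto
  moreover have "(\<epsilon> * p - 6 * \<epsilon>\<^sup>2) * M \<le> \<beta> * (p - 2 * \<epsilon>) * M"
  proof (rule mult_right_mono[OF _ M0])
    \<comment> \<open>The 6 is 2 + 4: the 2 comes from the \<open>2 * \<epsilon>\<close> in the
      target, the 4 from \<open>\<beta>\<close> and \<open>p \<le> 1\<close>.\<close>
    have "\<epsilon>\<^sup>2 * (4 * p) \<le> \<epsilon>\<^sup>2 * 4 + 8 * \<epsilon> ^ 3"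
      using p eps by (intro add_increasing2 mult_left_mono) auto
    then show "\<epsilon> * p - 6 * \<epsilon>\<^sup>2 \<le> \<beta> * (p - 2 * \<epsilon>)"
      by (simp add: \<beta>_def algebra_simps power2_eq_square power3_eq_cube)
  qed
  moreover have "(real (Suc j) * \<epsilon> * p - 6 * \<epsilon>\<^sup>2 * real (Suc j)) * M
      \<le> (1 - \<epsilon>) * ((real j * \<epsilon> * (1 - \<epsilon>) ^ j - 6 * \<epsilon>\<^sup>2 * real j) * M) + (\<epsilon> * p - 6 * \<epsilon>\<^sup>2) * M"
  proof -
    have "0 \<le> \<epsilon> * (6 * \<epsilon>\<^sup>2 * real j) * M" using eps M0 by simp
    then show ?thesis by (simp add: p_def algebra_simps)
  qed
  ultimately show ?case unfolding p_def by linarith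
qed

end

section \<open>Comparison with 1/e and the final bound\<close>

lemma inverse_exp_le_power:
  assumes "0 < N"
  shows "1 / exp 1 - 1 / real N \<le> (1 - 1 / real N) ^ N"
proof (cases "N = 1")
  case True
  then show ?thesis by simp
next
  case False
  then have N: "1 < real N" using assms by simp
  \<comment> \<open>The inverse of \<open>1 + 1 / (real N - 1)\<close> is
    \<open>1 - 1 / real N\<close>, so the power \<open>N - 1\<close> already stays above 1/e; the
    one remaining factor costs at most \<open>1 / real N\<close>.\<close>
  have "1 + 1 / (real N - 1) \<le> exp (1 / (real N - 1))"
    by (rule exp_ge_add_one_self)
  then have "(1 + 1 / (real N - 1)) ^ (N - 1) \<le> exp (1 / (real N - 1)) ^ (N - 1)"
    using N by (intro power_mono) auto
  also have "\<dots> = exp 1"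
    using N by (simp add: exp_of_nat_mult[symmetric] of_nat_diff)
  finally have "1 / exp 1 \<le> 1 / (1 + 1 / (real N - 1)) ^ (N - 1)"
    using N by (intro divide_left_mono) (auto intro!: mult_pos_pos zero_less_power add_pos_pos)
  also have "\<dots> = (1 - 1 / real N) ^ (N - 1)"
  proof -
    have "1 / (1 + 1 / (real N - 1)) = 1 - 1 / real N" using N by (simp add: field_simps)
    then show ?thesis by (metis power_one_over)
  qed
  finally have e: "1 / exp 1 \<le> (1 - 1 / real N) ^ (N - 1)" .
  have "1 / exp 1 * (1 / real N) \<le> 1 * (1 / real N)"
    by (intro mult_right_mono) auto
  then have "1 / exp 1 - 1 / real N \<le> 1 / exp 1 * (1 - 1 / real N)"
    by (simp add: right_diff_distrib)
  also have "\<dots> \<le> (1 - 1 / real N) ^ (N - 1) * (1 - 1 / real N)"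
    using e N by (intro mult_right_mono) auto
  also have "\<dots> = (1 - 1 / real N) ^ N" by (rule power_minus_mult[OF assms])
  finally show ?thesis .
qed

text \<open>Integrality makes the number of phases exactly \<open>1 / \<epsilon>\<close>, so the
  norm budget ends at \<open>k\<close>. The 13 is 12 + 1: the loss \<open>6 * \<epsilon> * M\<close>
  is at most \<open>12 * \<epsilon> * f xopt\<close>, and replacing
  \<open>(1 - \<epsilon>) ^ N\<close> by 1/e costs one more \<open>\<epsilon>\<close>.\<close>

lemma (in algorithm_A_analysis) returns_bounds:
  assumes int: "1 / \<epsilon> \<in> \<int>" and ret: "returns x"
  shows "l1_norm n x \<le> k" "(1 / exp 1 - 13 * \<epsilon>) * f xopt \<le> f x"
proof -
  define N where "N = nat \<lfloor>1 / \<epsilon>\<rfloor>"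
  have N: "real N = 1 / \<epsilon>"
    using int eps by (auto simp: N_def elim!: Ints_cases)
  then have Npos: "0 < N" using eps by (metis gr0I of_nat_0 zero_less_divide_1_iff less_irrefl)
  have eN: "\<epsilon> = 1 / real N" "real N * \<epsilon> = 1" using N eps by auto
  obtain z where ap: "after_phase N x z" using ret unfolding returns_def N_def by blast
  have inv: "invariant N x z" using ap by (rule after_phase_invariant)
  then have x: "x \<in> unit_cube n" and xz: "x \<le> z" and lz: "l1_norm n z \<le> \<epsilon> * real N * k"
    by (auto simp: invariant_def)
  have "\<epsilon> * real N * k = k" using eN(2) by (simp add: mult.commute)
  then show "l1_norm n x \<le> k" using l1_norm_mono[OF x xz] lz by linarith
  have f0: "0 \<le> f xopt" using nonneg opt by simp
  show "(1 / exp 1 - 13 * \<epsilon>) * f xopt \<le> f x"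
  \<comment> \<open>For larger \<open>\<epsilon>\<close> the factor
    \<open>1 / exp 1 - 13 * \<epsilon>\<close> is negative and nonnegativity of \<open>f\<close>
    suffices.\<close>
  proof (cases "\<epsilon> \<le> 1 / 4")
    case True
    have sq: "\<epsilon>\<^sup>2 * real N = \<epsilon>" using eN(2) by (simp add: power2_eq_square mult_ac)
    have "((1 - \<epsilon>) ^ N - 6 * \<epsilon>) * M \<le> f x"
      using after_phase_value[OF ap True] eN(2) sq by (simp add: mult.assoc)
    moreover have "(1 - \<epsilon>) ^ N * f xopt \<le> (1 - \<epsilon>) ^ N * M"
      using M eps by (intro mult_left_mono) auto
    moreover have "6 * \<epsilon> * M \<le> 6 * \<epsilon> * (2 * f xopt)"
    proof -
      have "(1 + \<epsilon>) * f xopt \<le> 2 * f xopt" using eps f0 by (intro mult_right_mono) auto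
      then show ?thesis using M eps by (intro mult_left_mono) auto
    qed
    moreover have "(1 / exp 1 - \<epsilon>) * f xopt \<le> (1 - \<epsilon>) ^ N * f xopt"
      using inverse_exp_le_power[OF Npos] f0 unfolding eN(1)[symmetric] by (intro mult_right_mono)
    ultimately show ?thesis by (simp add: algebra_simps)
  next
    case False
    have "1 / exp 1 \<le> (1 :: real)" by simp
    then have "1 / exp 1 - 13 * \<epsilon> \<le> 0" using False by linarith
    then have "(1 / exp 1 - 13 * \<epsilon>) * f xopt \<le> 0"
      using f0 by (intro mult_nonpos_nonneg)
    then show ?thesis using nonneg[OF x] by linarith
  qed
qed

theorem theorem4:
  "\<exists>C::real. \<forall>(n::nat) (f::vector \<Rightarrow> real) (grad::vector \<Rightarrow> vector) (k::real) (\<epsilon>::real) (M::real)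
      (xopt::vector) (x::vector).
     (\<forall>y\<in>unit_cube n. 0 \<le> f y) \<longrightarrow>
     DR_submodular n f grad \<longrightarrow>
     0 < k \<longrightarrow>
     0 < \<epsilon> \<longrightarrow> \<epsilon> < 1 \<longrightarrow> 1 / \<epsilon> \<in> \<int> \<longrightarrow>
     optimal_solution n f k xopt \<longrightarrow>
     f xopt \<le> M \<longrightarrow> M \<le> (1 + \<epsilon>) * f xopt \<longrightarrow>
     algorithm_A.returns n f grad k \<epsilon> M x \<longrightarrow>
     l1_norm n x \<le> k \<and> f x \<ge> (1 / exp 1 - C * \<epsilon>) * f xopt"
proof (intro exI[of _ 13] allI impI)
  fix n f grad k \<epsilon> M xopt x
  assume "\<forall>y\<in>unit_cube n. 0 \<le> f y" "DR_submodular n f grad" "0 < k" "0 < \<epsilon>" "\<epsilon> < 1"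
    and int: "1 / \<epsilon> \<in> \<int>" and "optimal_solution n f k xopt" "f xopt \<le> M" "M \<le> (1 + \<epsilon>) * f xopt"
    and ret: "algorithm_A.returns n f grad k \<epsilon> M x"
  then interpret algorithm_A_analysis n f grad k \<epsilon> M xopt
    by unfold_locales (auto simp: optimal_solution_def feasible_def)
  show "l1_norm n x \<le> k \<and> (1 / exp 1 - 13 * \<epsilon>) * f xopt \<le> f x"
    using returns_bounds[OF int ret] by simp
qed

end
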